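(* Fix an integer $k\ge 0$ and a real number $l\ge 0$. Then magnitude homology $\mathrm{MH}_{k,l}(-)$, sending a finite metric space $X$ to the abelian group $\mathrm{MH}_{k,l}(X)$ and an isometric embedding $f:X\to Y$ to the induced map $\mathrm{MH}_{k,l}(f):\mathrm{MH}_{k,l}(X)\to \mathrm{MH}_{k,l}(Y)$, is a functor $\mathrm{MH}_{k,l}(-):\mathbf{FinMet}_{iso}\to\mathbf{Ab}$ from the category of finite metric spaces with isometric embeddings to the category of abelian groups.
   Context: A finite metric space is a pair $(X,d)$ with $X$ a finite set and $d:X\times X\to\mathbb{R}_{\ge 0}$ a metric. $\mathbf{FinMet}_{iso}$ is the category whose objects are finite metric spaces and whose morphisms are isometric embeddings, i.e. injective maps $f:(X,d_X)\to(Y,d_Y)$ with $d_Y(f(x),f(x'))=d_X(x,x')$ for all $x,x'\in X$. $\mathbf{Ab}$ is the category of abelian groups. Magnitude homology. For a tuple $\sigma=(x_0,\dots,x_k)\in X^{k+1}$ put $\ell(\sigma)=d(x_0,x_1)+\cdots+d(x_{k-1},x_k)$. For real $l\ge 0$, $\mathrm{MC}_{k,l}(X)$ is the free abelian group generated by the tuples $(x_0,\dots,x_k)\in X^{k+1}$ with $x_i\ne x_{i+1}$ for all $0\le i\le k-1$ and $\ell(x_0,\dots,x_k)=l$ (and it is $0$ for $k<0$). The boundary operator is $d_{k,l}=\sum_{i=0}^k(-1)^i\partial_{i,l}:\mathrm{MC}_{k,l}(X)\to\mathrm{MC}_{k-1,l}(X)$, where $\partial_{i,l}(x_0,\dots,x_k)=(x_0,\dots,\widehat{x}_i,\dots,x_k)$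 (omit $x_i$) if $\ell(x_0,\dots,\widehat{x}_i,\dots,x_k)=l$, and $\partial_{i,l}(x_0,\dots,x_k)=0$ otherwise. Then $d_{k-1,l}\circ d_{k,l}=0$ and $\mathrm{MH}_{k,l}(X)=\ker d_{k,l}/\operatorname{im} d_{k+1,l}$. For an isometric embedding $f:X\to Y$, the induced map is $\mathrm{MH}_{k,l}(f)([z])=[f_*(z)]$, where $f_*:\mathrm{MC}_{k,l}(X)\to\mathrm{MC}_{k,l}(Y)$ is given on generators by $f_*(x_0,\dots,x_k)=(f(x_0),\dots,f(x_k))$. *)

theory Defs
  imports "HOL-Analysis.Abstract_Metric_Spaces" "HOL-Algebra.Free_Abelian_Groups"
begin

section \<open>Categories and functors\<close>

text \<open>
  Hom-sets need not be disjoint, so composition takes the three objects as arguments: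
  \<open>Comp C X Y Z g f\<close> is the composite of \<open>f : X \<rightarrow> Y\<close> and \<open>g : Y \<rightarrow> Z\<close>.
\<close>

record ('o, 'm) cat_data =
  Obj :: "'o set"
  Hom :: "'o \<Rightarrow> 'o \<Rightarrow> 'm set"
  Id :: "'o \<Rightarrow> 'm"
  Comp :: "'o \<Rightarrow> 'o \<Rightarrow> 'o \<Rightarrow> 'm \<Rightarrow> 'm \<Rightarrow> 'm"

locale category =
  fixes C :: "('o, 'm) cat_data"
  assumes Id_in_Hom: "X \<in> Obj C \<Longrightarrow> Id C X \<in> Hom C X X"
    and Comp_in_Hom: "\<lbrakk>X \<in> Obj C; Y \<in> Obj C; Z \<in> Obj C; f \<in> Hom C X Y; g \<in> Hom C Y Z\<rbrakk>
      \<Longrightarrow> Comp C X Y Z g f \<in> Hom C X Z"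
    and Comp_Id_right: "\<lbrakk>X \<in> Obj C; Y \<in> Obj C; f \<in> Hom C X Y\<rbrakk>
      \<Longrightarrow> Comp C X X Y f (Id C X) = f"
    and Comp_Id_left: "\<lbrakk>X \<in> Obj C; Y \<in> Obj C; f \<in> Hom C X Y\<rbrakk>
      \<Longrightarrow> Comp C X Y Y (Id C Y) f = f"
    and Comp_assoc: "\<lbrakk>W \<in> Obj C; X \<in> Obj C; Y \<in> Obj C; Z \<in> Obj C;
        f \<in> Hom C W X; g \<in> Hom C X Y; h \<in> Hom C Y Z\<rbrakk>
      \<Longrightarrow> Comp C W Y Z h (Comp C W X Y g f) = Comp C W X Z (Comp C X Y Z h g) f"

locale cat_functor = C: category C + D: category D
  for C :: "('o1, 'm1) cat_data" and D :: "('o2, 'm2) cat_data" +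
  fixes Fo :: "'o1 \<Rightarrow> 'o2"
    and Fm :: "'o1 \<Rightarrow> 'o1 \<Rightarrow> 'm1 \<Rightarrow> 'm2"
  assumes Fo_in_Obj: "X \<in> Obj C \<Longrightarrow> Fo X \<in> Obj D"
    and Fm_in_Hom: "\<lbrakk>X \<in> Obj C; Y \<in> Obj C; f \<in> Hom C X Y\<rbrakk>
      \<Longrightarrow> Fm X Y f \<in> Hom D (Fo X) (Fo Y)"
    and Fm_Id: "X \<in> Obj C \<Longrightarrow> Fm X X (Id C X) = Id D (Fo X)"
    and Fm_Comp: "\<lbrakk>X \<in> Obj C; Y \<in> Obj C; Z \<in> Obj C; f \<in> Hom C X Y; g \<in> Hom C Y Z\<rbrakk>
      \<Longrightarrow> Fm X Z (Comp C X Y Z g f) = Comp D (Fo X) (Fo Y) (Fo Z) (Fm Y Z g) (Fm X Y f)"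

text \<open>
  In both concrete categories a morphism is a HOL function that is \<^const>\<open>undefined\<close> outside the
  carrier of its domain, so that equality of morphisms is pointwise equality on that carrier.
\<close>

definition isometric_embeddings :: "'a metric \<Rightarrow> 'b metric \<Rightarrow> ('a \<Rightarrow> 'b) set" where
  "isometric_embeddings X Y =
    {f \<in> mspace X \<rightarrow>\<^sub>E mspace Y. inj_on f (mspace X) \<and>
      (\<forall>x\<in>mspace X. \<forall>x'\<in>mspace X. mdist Y (f x) (f x') = mdist X x x')}"

definition FinMet_iso :: "('a metric, 'a \<Rightarrow> 'a) cat_data" where
  "FinMet_iso =
    \<lparr>Obj = {X. finite (mspace X)},
     Hom = isometric_embeddings,
     Id = (\<lambda>X. \<lambda>x\<in>mspace X. x),
     Comp = (\<lambda>X Y Z g f. compose (mspace X) g f)\<rparr>"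

definition Ab :: "('b monoid, 'b \<Rightarrow> 'b) cat_data" where
  "Ab =
    \<lparr>Obj = {G. comm_group G},
     Hom = (\<lambda>G H. hom G H \<inter> extensional (carrier G)),
     Id = (\<lambda>G. \<lambda>x\<in>carrier G. x),
     Comp = (\<lambda>G H K \<psi> \<phi>. compose (carrier G) \<psi> \<phi>)\<rparr>"

section \<open>Magnitude homology\<close>

text \<open>A tuple \<open>(x\<^sub>0, \<dots>, x\<^sub>k)\<close> is a list of length \<open>k + 1\<close>.\<close>

definition tuple_length :: "'a metric \<Rightarrow> 'a list \<Rightarrow> real" where
  "tuple_length X xs = (\<Sum>i<length xs - 1. mdist X (xs ! i) (xs ! Suc i))"

text \<open>Degrees are integers; there are no generators in negative degrees.\<close>

definition mag_tuples :: "int \<Rightarrow> real \<Rightarrow> 'a metric \<Rightarrow> 'a list set" where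
  "mag_tuples k l X =
    {xs. 0 \<le> k \<and> int (length xs) = k + 1 \<and> set xs \<subseteq> mspace X \<and>
      (\<forall>i. Suc i < length xs \<longrightarrow> xs ! i \<noteq> xs ! Suc i) \<and> tuple_length X xs = l}"

definition MC :: "int \<Rightarrow> real \<Rightarrow> 'a metric \<Rightarrow> ('a list \<Rightarrow>\<^sub>0 int) monoid" where
  "MC k l X = free_Abelian_group (mag_tuples k l X)"

definition omit_nth :: "nat \<Rightarrow> 'a list \<Rightarrow> 'a list" where
  "omit_nth i xs = take i xs @ drop (Suc i) xs"

definition mag_face :: "real \<Rightarrow> 'a metric \<Rightarrow> nat \<Rightarrow> 'a list \<Rightarrow> ('a list \<Rightarrow>\<^sub>0 int)" where
  "mag_face l X i xs =
    (if tuple_length X (omit_nth i xs) = l then frag_of (omit_nth i xs) else 0)"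

text \<open>
  The case \<open>k \<le> 0\<close> has to be set apart: \<open>MC (-1) l X\<close> is trivial, but omitting the entry of a
  1-tuple would leave the empty list, whose \<^const>\<open>tuple_length\<close> is 0.
\<close>

definition mag_boundary ::
    "int \<Rightarrow> real \<Rightarrow> 'a metric \<Rightarrow> ('a list \<Rightarrow>\<^sub>0 int) \<Rightarrow> ('a list \<Rightarrow>\<^sub>0 int)" where
  "mag_boundary k l X c =
    (if k \<le> 0 then 0
     else frag_extend (\<lambda>xs. \<Sum>i\<le>nat k. frag_cmul ((-1) ^ i) (mag_face l X i xs)) c)"

definition mag_cycles :: "int \<Rightarrow> real \<Rightarrow> 'a metric \<Rightarrow> ('a list \<Rightarrow>\<^sub>0 int) set" where
  "mag_cycles k l X = kernel (MC k l X) (MC (k - 1) l X) (mag_boundary k l X)"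

definition mag_boundaries :: "int \<Rightarrow> real \<Rightarrow> 'a metric \<Rightarrow> ('a list \<Rightarrow>\<^sub>0 int) set" where
  "mag_boundaries k l X = mag_boundary (k + 1) l X ` carrier (MC (k + 1) l X)"

definition MH :: "int \<Rightarrow> real \<Rightarrow> 'a metric \<Rightarrow> ('a list \<Rightarrow>\<^sub>0 int) set monoid" where
  "MH k l X = (MC k l X)\<lparr>carrier := mag_cycles k l X\<rparr> Mod mag_boundaries k l X"

definition mag_class :: "int \<Rightarrow> real \<Rightarrow> 'a metric \<Rightarrow> ('a list \<Rightarrow>\<^sub>0 int) \<Rightarrow> ('a list \<Rightarrow>\<^sub>0 int) set" where
  "mag_class k l X z = mag_boundaries k l X #>\<^bsub>MC k l X\<^esub> z"

definition MC_map :: "('a \<Rightarrow> 'b) \<Rightarrow> ('a list \<Rightarrow>\<^sub>0 int) \<Rightarrow> ('b list \<Rightarrow>\<^sub>0 int)" where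
  "MC_map f = frag_extend (\<lambda>xs. frag_of (map f xs))"

text \<open>
  The union over all representatives \<open>z\<close> of the class \<open>c\<close> avoids a choice: it is a single class
  precisely when the class of \<open>MC_map f z\<close> does not depend on \<open>z\<close>, and then it is that class.
\<close>

definition MH_map ::
    "int \<Rightarrow> real \<Rightarrow> 'a metric \<Rightarrow> 'b metric \<Rightarrow> ('a \<Rightarrow> 'b)
      \<Rightarrow> ('a list \<Rightarrow>\<^sub>0 int) set \<Rightarrow> ('b list \<Rightarrow>\<^sub>0 int) set" where
  "MH_map k l X Y f = (\<lambda>c\<in>carrier (MH k l X). \<Union>z\<in>c. mag_class k l Y (MC_map f z))"

end

theory Submission
  imports Defs
begin

text \<open>
  An isometric embedding maps generators to generators of the same length and commutes with the
  deletion of points, hence with all faces; so it induces a chain map, and functoriality passes from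
  generators to classes. The boundary squares to zero by the simplicial identities: these survive
  the vanishing of length-changing faces because, by the triangle inequality, deleting points never
  lengthens a tuple, so a double deletion preserves the length only if both of its steps do.
\<close>

section \<open>Tuples\<close>

text \<open>Turns the indexed sum into a recursion on lists. Truncated subtraction in
  \<open>length xs - 1\<close> makes the sum empty for lists with at most one entry.\<close>

lemma tuple_length_simps [simp]:
  "tuple_length X [] = 0"
  "tuple_length X [x] = 0"
  "tuple_length X (x # y # xs) = mdist X x y + tuple_length X (y # xs)"
  by (simp_all add: tuple_length_def sum.lessThan_Suc_shift del: sum.lessThan_Suc)

text \<open>The length sums over gaps between neighbours, so cutting at an entry \<open>a\<close>
  loses no gap provided that \<open>a\<close> is kept on both sides. This localizes the effect of a
  deletion.\<close>

lemma tuple_length_append: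
  "tuple_length X (us @ a # vs) = tuple_length X (us @ [a]) + tuple_length X (a # vs)"
proof (induction us)
  case (Cons u us)
  then show ?case by (cases us) auto
qed simp

lemma tuple_length_map:
  assumes "\<And>x y. \<lbrakk>x \<in> set xs; y \<in> set xs\<rbrakk> \<Longrightarrow> mdist Y (f x) (f y) = mdist X x y"
  shows "tuple_length Y (map f xs) = tuple_length X xs"
  unfolding tuple_length_def by (rule sum.cong) (use assms in auto)

text \<open>The stretches up to \<open>a\<close> and from \<open>c\<close> on are common to both
  tuples and cancel. What remains is the triangle defect at \<open>b\<close>.\<close>

lemma tuple_length_delete_inner:
  "tuple_length X (us @ a # b # c # vs) - tuple_length X (us @ a # c # vs)
    = mdist X a b + mdist X b c - mdist X a c"
  by (simp add: tuple_length_append [of X us a "b # c # vs"] tuple_length_append [of X us a "c # vs"])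

lemma tuple_length_delete_le:
  assumes "set (us @ b # vs) \<subseteq> mspace X"
  shows "tuple_length X (us @ vs) \<le> tuple_length X (us @ b # vs)"
\<comment> \<open>Distinguishes whether \<open>b\<close> has neighbours on the left and on the
  right. At an end of the tuple at most one nonnegative distance is lost; inside it, the triangle
  inequality decides.\<close>
proof (cases us rule: rev_cases)
  case Nil
  then show ?thesis by (cases vs) auto
next
  case us: (snoc us' a)
  show ?thesis
  proof (cases vs)
    case Nil
    then show ?thesis
      using us by (simp add: tuple_length_append [of X us' a "[b]"])
  next
    case (Cons c vs')
    then show ?thesis
      using us assms tuple_length_delete_inner [of X us' a b c vs'] mdist_triangle [of a X b c]
      by simp
  qed
qed

text \<open>The only new adjacency is between the neighbours \<open>a\<close> and \<open>c\<close>
  of \<open>b\<close>. If they coincided, preservation of length would give d(a,b) + d(b,a) = 0,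
  hence a = b, against the distinctness of neighbours before the deletion.\<close>

lemma distinct_adj_delete:
  assumes "set (us @ b # vs) \<subseteq> mspace X" "distinct_adj (us @ b # vs)"
    and "tuple_length X (us @ vs) = tuple_length X (us @ b # vs)"
  shows "distinct_adj (us @ vs)"
proof (cases us rule: rev_cases)
  case Nil
  then show ?thesis using assms(2) by (cases vs) auto
next
  case us: (snoc us' a)
  show ?thesis
  proof (cases vs)
    case Nil
    then show ?thesis
      using assms(2) us by (auto simp: distinct_adj_append_iff)
  next
    case (Cons c vs')
    have "a \<noteq> c"
    proof
      assume "a = c"
      then have "mdist X a b + mdist X b a = 0"
        using us Cons assms tuple_length_delete_inner [of X us' a b c vs'] by simp
      then have "mdist X a b = 0"
        by (simp add: mdist_commute)
      then show False
        using assms(1,2) us Cons by (auto simp: distinct_adj_append_iff)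
    qed
    then show ?thesis
      using assms(2) us Cons by (auto simp: distinct_adj_append_iff)
  qed
qed

section \<open>Deletion by position and the generators of the chain groups\<close>

lemma omit_nth_append: "omit_nth (length us) (us @ b # vs) = us @ vs"
  by (simp add: omit_nth_def)

lemma split_at_nth:
  assumes "i < length xs"
  obtains us b vs where "xs = us @ b # vs" "i = length us"
  using assms id_take_nth_drop [of i xs] that [of "take i xs" "xs ! i" "drop (Suc i) xs"] by simp

lemma set_omit_nth_subset: "set (omit_nth i xs) \<subseteq> set xs"
  unfolding omit_nth_def by (auto dest: in_set_takeD in_set_dropD)

lemma length_omit_nth: "i < length xs \<Longrightarrow> length (omit_nth i xs) = length xs - 1"
  by (simp add: omit_nth_def)

lemma map_omit_nth: "map f (omit_nth i xs) = omit_nth i (map f xs)"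
  by (simp add: omit_nth_def take_map drop_map)

text \<open>The simplicial identity. Deleting the later position first leaves position
  \<open>i\<close> in place, whereas deleting \<open>i\<close> first moves the entry at
  \<open>Suc j\<close> to \<open>j\<close>.\<close>

lemma omit_nth_omit_nth:
  assumes "i \<le> j" "Suc j < length xs"
  shows "omit_nth i (omit_nth (Suc j) xs) = omit_nth j (omit_nth i xs)"
  by (rule nth_equalityI) (use assms in \<open>auto simp: omit_nth_def nth_append min_def\<close>)

lemma tuple_length_omit_nth_le:
  assumes "set xs \<subseteq> mspace X" "i < length xs"
  shows "tuple_length X (omit_nth i xs) \<le> tuple_length X xs"
  using assms(2)
proof (rule split_at_nth)
  fix us b vs
  assume "xs = us @ b # vs" "i = length us"
  then show ?thesis
    using assms(1) tuple_length_delete_le [of us b vs X] by (simp add: omit_nth_append)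
qed

lemma mag_tuples_iff:
  "xs \<in> mag_tuples k l X \<longleftrightarrow>
    0 \<le> k \<and> int (length xs) = k + 1 \<and> set xs \<subseteq> mspace X \<and> distinct_adj xs \<and> tuple_length X xs = l"
  by (auto simp: mag_tuples_def distinct_adj_def successively_conv_nth)

text \<open>Nonzero faces are generators one degree lower: the length condition that makes a face
  nonzero also keeps its neighbours distinct. With \<open>0 < k\<close> the new degree is still
  nonnegative.\<close>

lemma omit_nth_in_mag_tuples:
  assumes xs: "xs \<in> mag_tuples k l X" and "0 < k" "i \<le> nat k"
    and l: "tuple_length X (omit_nth i xs) = l"
  shows "omit_nth i xs \<in> mag_tuples (k - 1) l X"
proof -
  have i: "i < length xs"
    using assms by (auto simp: mag_tuples_iff)
  then obtain us b vs where *: "xs = us @ b # vs" "i = length us"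
    by (rule split_at_nth)
  have "distinct_adj (omit_nth i xs)"
    using xs l distinct_adj_delete [of us b vs X] unfolding * mag_tuples_iff omit_nth_append by simp
  then show ?thesis
    using assms i set_omit_nth_subset [of i xs] by (auto simp: mag_tuples_iff length_omit_nth)
qed

section \<open>The chain complex\<close>

lemma carrier_MC_iff: "c \<in> carrier (MC k l X) \<longleftrightarrow> Poly_Mapping.keys c \<subseteq> mag_tuples k l X"
  by (simp add: MC_def)

lemma mult_MC [simp]: "x \<otimes>\<^bsub>MC k l X\<^esub> y = x + y"
  by (simp add: MC_def)

lemma one_MC [simp]: "\<one>\<^bsub>MC k l X\<^esub> = 0"
  by (simp add: MC_def)

lemma comm_group_MC: "comm_group (MC k l X)"
  by (simp add: MC_def abelian_free_Abelian_group)

lemma group_MC: "group (MC k l X)"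
  by (simp add: MC_def)

lemma zero_in_MC [simp]: "0 \<in> carrier (MC k l X)"
  by (simp add: carrier_MC_iff)

section \<open>The boundary operator and its square\<close>

lemma mag_boundary_add: "mag_boundary k l X (a + b) = mag_boundary k l X a + mag_boundary k l X b"
  by (simp add: mag_boundary_def frag_extend_add)

lemma mag_boundary_diff: "mag_boundary k l X (a - b) = mag_boundary k l X a - mag_boundary k l X b"
  by (simp add: mag_boundary_def frag_extend_diff)

lemma mag_boundary_0 [simp]: "mag_boundary k l X 0 = 0"
  by (simp add: mag_boundary_def)

lemma mag_boundary_in_MC:
  assumes "c \<in> carrier (MC k l X)"
  shows "mag_boundary k l X c \<in> carrier (MC (k - 1) l X)"
proof (cases "k \<le> 0")
  case False
  \<comment> \<open>By linear extension it suffices to bound the support of the boundary of a single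
    generator; each of its faces is zero or a generator.\<close>
  have "Poly_Mapping.keys (\<Sum>i\<le>nat k. frag_cmul ((- 1) ^ i) (mag_face l X i xs))
      \<subseteq> mag_tuples (k - 1) l X" if xs: "xs \<in> mag_tuples k l X" for xs
  proof (rule order.trans [OF keys_sum], rule UN_least)
    fix i
    assume "i \<in> {..nat k}"
    then show "Poly_Mapping.keys (frag_cmul ((- 1) ^ i) (mag_face l X i xs)) \<subseteq> mag_tuples (k - 1) l X"
      using omit_nth_in_mag_tuples [OF xs] False by (auto simp: mag_face_def)
  qed
  then have "Poly_Mapping.keys (mag_boundary k l X c) \<subseteq> mag_tuples (k - 1) l X"
    using False assms unfolding carrier_MC_iff mag_boundary_def
    by (auto dest!: subsetD [OF keys_frag_extend])
  then show ?thesis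
    by (simp add: carrier_MC_iff)
qed (simp add: mag_boundary_def)

text \<open>Terms cancel in pairs: (i, j) with i \<le> j is matched with (j + 1, i), which carries
  the same value by the symmetry of \<open>A\<close> and the opposite sign. Here
  \<open>A j i\<close> stands for deleting \<open>j\<close> first and then \<open>i\<close>.\<close>

lemma alternating_double_sum_eq_0:
  assumes "\<And>i j. \<lbrakk>i \<le> j; j \<le> n\<rbrakk> \<Longrightarrow> A (Suc j) i = A i j"
  shows "(\<Sum>j\<le>Suc n. \<Sum>i\<le>n. frag_cmul ((-1) ^ (j + i)) (A j i)) = 0"
proof -
  \<comment> \<open>Exhibits the pairs with \<open>i < j\<close> as a shifted copy of the
    complementary pairs, so that both partial sums can be taken over one index set.\<close>
  have lower: "{..Suc n} \<times> {..n} \<inter> {(j, i). i < j} = (\<lambda>(i, j). (Suc j, i)) ` {(i, j). i \<le> j \<and> j \<le> n}"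
  proof -
    have "(j, i) \<in> (\<lambda>(i, j). (Suc j, i)) ` {(i, j). i \<le> j \<and> j \<le> n}" if "i < j" "j \<le> Suc n" for i j
      \<comment> \<open>From \<open>i < j\<close> it follows that \<open>j\<close> is positive, so
        \<open>j - 1\<close> is its true predecessor and \<open>i\<close> is at most
        \<open>j - 1\<close>, which is at most \<open>n\<close>.\<close>
      using that by (intro image_eqI [of _ _ "(i, j - 1)"]) auto
    then show ?thesis
      by auto
  qed
  have upper: "{..Suc n} \<times> {..n} - {(j, i). i < j} = {(i, j). i \<le> j \<and> j \<le> n}"
    by auto
  have inj: "inj_on (\<lambda>(i, j). (Suc j, i)) S" for S :: "(nat \<times> nat) set"
    by (auto simp: inj_on_def)
  have "(\<Sum>j\<le>Suc n. \<Sum>i\<le>n. frag_cmul ((-1) ^ (j + i)) (A j i))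
    = (\<Sum>(j, i)\<in>{..Suc n} \<times> {..n} \<inter> {(j, i). i < j}. frag_cmul ((-1) ^ (j + i)) (A j i))
    + (\<Sum>(j, i)\<in>{..Suc n} \<times> {..n} - {(j, i). i < j}. frag_cmul ((-1) ^ (j + i)) (A j i))"
    unfolding sum.cartesian_product by (rule sum.Int_Diff) simp
  also have "\<dots> = (\<Sum>(i, j)\<in>{(i, j). i \<le> j \<and> j \<le> n}. frag_cmul ((-1) ^ (Suc j + i)) (A (Suc j) i))
    + (\<Sum>(i, j)\<in>{(i, j). i \<le> j \<and> j \<le> n}. frag_cmul ((-1) ^ (i + j)) (A i j))"
    unfolding lower upper sum.reindex [OF inj] by (simp add: comp_def case_prod_unfold)
  also have "\<dots> = (\<Sum>(i, j)\<in>{(i, j). i \<le> j \<and> j \<le> n}.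
      frag_cmul ((-1) ^ (Suc j + i)) (A (Suc j) i) + frag_cmul ((-1) ^ (i + j)) (A i j))"
    by (simp add: sum.distrib case_prod_unfold)
  also have "\<dots> = 0"
    by (rule sum.neutral) (auto simp: assms add.commute simp flip: frag_cmul_distrib)
  finally show ?thesis .
qed

lemma mag_boundary_mag_boundary:
  assumes "c \<in> carrier (MC (k + 1) l X)"
  shows "mag_boundary k l X (mag_boundary (k + 1) l X c) = 0"
proof (cases "k \<le> 0")
  case False
  define n where "n = nat k"
  have n: "nat (k + 1) = Suc n" "k = int n"
    using False by (auto simp: n_def)
  have "Poly_Mapping.keys c \<subseteq> mag_tuples (k + 1) l X"
    using assms by (simp add: carrier_MC_iff)
  then show ?thesis
  proof (induction c rule: frag_induction)
    case (one xs)
    then have xs: "length xs = Suc (Suc n)" "set xs \<subseteq> mspace X" "tuple_length X xs = l"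
      by (auto simp: mag_tuples_iff n)
    \<comment> \<open>The length is tested only once, after both deletions. The value thus depends
      on the twice shortened list alone, which makes it symmetric under the simplicial
      identity.\<close>
    define A where "A j i = (if tuple_length X (omit_nth i (omit_nth j xs)) = l
      then frag_of (omit_nth i (omit_nth j xs)) else 0)" for j i
    have face: "mag_boundary k l X (mag_face l X j xs) = (\<Sum>i\<le>n. frag_cmul ((-1) ^ i) (A j i))"
      if "j \<le> Suc n" for j
    proof (cases "tuple_length X (omit_nth j xs) = l")
      case True
      then show ?thesis
        using False by (simp add: mag_boundary_def mag_face_def A_def n_def)
    next
      case neq: False
      \<comment> \<open>Once the first deletion has shortened the tuple below \<open>l\<close>, the
        second cannot bring the length back. So leaving out the intermediate test in
        \<open>A\<close> changes nothing.\<close>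
      have "A j i = 0" if "i \<le> n" for i
      proof -
        have "tuple_length X (omit_nth i (omit_nth j xs)) \<le> tuple_length X (omit_nth j xs)"
          using xs \<open>i \<le> n\<close> \<open>j \<le> Suc n\<close> set_omit_nth_subset [of j xs]
          by (intro tuple_length_omit_nth_le) (auto simp: length_omit_nth)
        moreover have "tuple_length X (omit_nth j xs) \<le> l"
          using xs \<open>j \<le> Suc n\<close> tuple_length_omit_nth_le [of xs X j] by simp
        ultimately show ?thesis
          using neq by (simp add: A_def)
      qed
      then show ?thesis
        using neq by (simp add: mag_face_def)
    qed
    have "mag_boundary k l X (mag_boundary (k + 1) l X (frag_of xs))
      = mag_boundary k l X (\<Sum>j\<le>Suc n. frag_cmul ((-1) ^ j) (mag_face l X j xs))"
      using False by (simp add: mag_boundary_def [of "k + 1"] n(1) del: sum.atMost_Suc)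
    also have "\<dots> = (\<Sum>j\<le>Suc n. frag_cmul ((-1) ^ j) (mag_boundary k l X (mag_face l X j xs)))"
      using False by (simp add: mag_boundary_def frag_extend_sum frag_extend_cmul comp_def
          del: sum.atMost_Suc)
    also have "\<dots> = (\<Sum>j\<le>Suc n. \<Sum>i\<le>n. frag_cmul ((-1) ^ (j + i)) (A j i))"
      by (rule sum.cong) (simp_all add: face frag_cmul_sum power_add)
    also have "\<dots> = 0"
      by (rule alternating_double_sum_eq_0) (simp add: A_def omit_nth_omit_nth xs)
    finally show ?case .
  qed (simp_all add: mag_boundary_diff)
\<comment> \<open>For \<open>k \<le> 0\<close> the outer boundary is zero by definition.\<close>
qed (simp add: mag_boundary_def)

section \<open>Cycles and boundaries as subgroups\<close>

lemma mag_cycles_iff: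
  "z \<in> mag_cycles k l X \<longleftrightarrow> z \<in> carrier (MC k l X) \<and> mag_boundary k l X z = 0"
  by (simp add: mag_cycles_def kernel_def)

lemma mag_boundary_group_hom: "group_hom (MC k l X) (MC (k - 1) l X) (mag_boundary k l X)"
  by (auto simp: group_hom_def group_hom_axioms_def group_MC hom_def mag_boundary_in_MC mag_boundary_add)

lemma subgroup_mag_cycles: "subgroup (mag_cycles k l X) (MC k l X)"
  unfolding mag_cycles_def by (rule group_hom.subgroup_kernel [OF mag_boundary_group_hom])

lemma subgroup_mag_boundaries: "subgroup (mag_boundaries k l X) (MC k l X)"
  using group_hom.img_is_subgroup [OF mag_boundary_group_hom [of "k + 1"]]
  by (simp add: mag_boundaries_def)

lemma mag_boundaries_subset_mag_cycles: "mag_boundaries k l X \<subseteq> mag_cycles k l X"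
  using mag_boundary_in_MC [of _ "k + 1"]
  by (auto simp: mag_boundaries_def mag_cycles_iff mag_boundary_mag_boundary)

section \<open>Homology classes\<close>

lemma mag_cycles_add:
  "\<lbrakk>z \<in> mag_cycles k l X; w \<in> mag_cycles k l X\<rbrakk> \<Longrightarrow> z + w \<in> mag_cycles k l X"
  using subgroup.m_closed [OF subgroup_mag_cycles] by fastforce

lemma mag_class_iff: "y \<in> mag_class k l X z \<longleftrightarrow> (\<exists>b\<in>mag_boundaries k l X. y = b + z)"
  by (auto simp: mag_class_def r_coset_def)

lemma mag_class_self: "z \<in> mag_class k l X z"
  using subgroup.one_closed [OF subgroup_mag_boundaries [of k l X]] by (force simp: mag_class_iff)

text \<open>Makes classes insensitive to the choice of representative; the well-definedness of
  induced maps rests on it.\<close>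

lemma mag_class_add_boundary:
  assumes "b \<in> mag_boundaries k l X" "z \<in> mag_cycles k l X"
  shows "mag_class k l X (b + z) = mag_class k l X z"
  unfolding mag_class_def
  using assms group.repr_independence [OF group_MC _ _ subgroup_mag_boundaries, of "b + z" k l X z]
  by (auto simp: mag_cycles_iff r_coset_def)

text \<open>\<open>mag_class\<close> forms cosets in the group of all chains, \<open>MH\<close> in
  the group of cycles. Restricting the carrier leaves the multiplication unchanged, so they are the
  same sets.\<close>

lemma carrier_MH: "carrier (MH k l X) = mag_class k l X ` mag_cycles k l X"
  by (auto simp: MH_def carrier_FactGroup mag_class_def r_coset_def)

lemma mult_MH:
  assumes "z \<in> mag_cycles k l X" "w \<in> mag_cycles k l X"
  shows "mag_class k l X z \<otimes>\<^bsub>MH k l X\<^esub> mag_class k l X w = mag_class k l X (z + w)"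
proof -
  \<comment> \<open>The product of cosets is computed in the full chain group, where the boundaries
    are normal by commutativity. It carries over because \<open>set_mult\<close> sees only the
    multiplication.\<close>
  have "mag_boundaries k l X \<lhd> MC k l X"
    by (simp add: comm_group.subgroup_imp_normal comm_group_MC subgroup_mag_boundaries)
  then have "mag_class k l X z <#>\<^bsub>MC k l X\<^esub> mag_class k l X w = mag_class k l X (z + w)"
    using assms normal.rcos_sum [of _ "MC k l X" z w] by (simp add: mag_class_def mag_cycles_iff)
  then show ?thesis
    by (simp add: MH_def set_mult_def)
qed

lemma comm_group_MH: "comm_group (MH k l X)"
  unfolding MH_def
proof (rule comm_group.abelian_FactGroup)
  show "comm_group (MC k l X\<lparr>carrier := mag_cycles k l X\<rparr>)"
    using subgroup.subgroup_is_group [OF subgroup_mag_cycles group_MC]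
    by (rule group.group_comm_groupI) (simp add: add.commute)
  show "subgroup (mag_boundaries k l X) (MC k l X\<lparr>carrier := mag_cycles k l X\<rparr>)"
    by (simp add: group.subgroup_incl group_MC subgroup_mag_boundaries subgroup_mag_cycles
        mag_boundaries_subset_mag_cycles)
qed

section \<open>Induced maps\<close>

lemma MC_map_add: "MC_map f (a + b) = MC_map f a + MC_map f b"
  by (simp add: MC_map_def frag_extend_add)

lemma MC_map_diff: "MC_map f (a - b) = MC_map f a - MC_map f b"
  by (simp add: MC_map_def frag_extend_diff)

lemma MC_map_of [simp]: "MC_map f (frag_of xs) = frag_of (map f xs)"
  by (simp add: MC_map_def)

lemma MC_map_0 [simp]: "MC_map f 0 = 0"
  by (simp add: MC_map_def)

text \<open>\<open>compose (mspace X) g f\<close> agrees with the plain composite only on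
  \<open>mspace X\<close>, so the chain must be supported on tuples with entries there.\<close>

lemma MC_map_compose:
  assumes "c \<in> carrier (MC k l X)"
  shows "MC_map (compose (mspace X) g f) c = MC_map g (MC_map f c)"
  using assms unfolding carrier_MC_iff
proof (induction c rule: frag_induction)
  case (one xs)
  then have "map (compose (mspace X) g f) xs = map g (map f xs)"
    by (auto simp: mag_tuples_iff compose_eq)
  then show ?case
    by (simp del: map_map)
qed (simp_all add: MC_map_diff)

lemma MC_map_id:
  assumes "c \<in> carrier (MC k l X)"
  shows "MC_map (\<lambda>x\<in>mspace X. x) c = c"
  using assms unfolding carrier_MC_iff
proof (induction c rule: frag_induction)
  case (one xs)
  then have "map (\<lambda>x\<in>mspace X. x) xs = xs"
    by (intro map_idI) (auto simp: mag_tuples_iff)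
  then show ?case
    by (simp only: MC_map_of)
qed (simp_all add: MC_map_diff)

section \<open>The chain map and the map on homology induced by an isometric embedding\<close>

context
  fixes X :: "'a metric" and Y :: "'b metric" and f
  assumes f: "f \<in> isometric_embeddings X Y"
begin

lemma tuple_length_map_isometric: "set xs \<subseteq> mspace X \<Longrightarrow> tuple_length Y (map f xs) = tuple_length X xs"
  using f by (intro tuple_length_map) (auto simp: isometric_embeddings_def)

text \<open>Injectivity keeps neighbours distinct, and preservation of distances keeps the
  length.\<close>

lemma map_in_mag_tuples:
  assumes "xs \<in> mag_tuples k l X"
  shows "map f xs \<in> mag_tuples k l Y"
proof -
  have "inj_on f (set xs)" "f ` set xs \<subseteq> mspace Y"
    using f assms by (auto simp: isometric_embeddings_def mag_tuples_iff intro: inj_on_subset)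
  then show ?thesis
    using assms by (simp add: mag_tuples_iff tuple_length_map_isometric distinct_adj_map_iff)
qed

lemma MC_map_in_MC:
  assumes "c \<in> carrier (MC k l X)"
  shows "MC_map f c \<in> carrier (MC k l Y)"
  using assms keys_frag_extend [of "\<lambda>xs. frag_of (map f xs)" c] map_in_mag_tuples
  unfolding carrier_MC_iff MC_map_def by fastforce

text \<open>The shortened tuple and its image have equal length, so the test deciding whether a face
  vanishes has the same outcome in \<open>X\<close> and in \<open>Y\<close>.\<close>

lemma MC_map_mag_face:
  assumes "set xs \<subseteq> mspace X"
  shows "MC_map f (mag_face l X i xs) = mag_face l Y i (map f xs)"
  using assms set_omit_nth_subset [of i xs] tuple_length_map_isometric [of "omit_nth i xs"]
  by (simp add: mag_face_def map_omit_nth)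

lemma MC_map_mag_boundary:
  assumes "c \<in> carrier (MC k l X)"
  shows "MC_map f (mag_boundary k l X c) = mag_boundary k l Y (MC_map f c)"
proof (cases "k \<le> 0")
  case False
  show ?thesis
    using assms unfolding carrier_MC_iff
  proof (induction c rule: frag_induction)
    case (one xs)
    then have "set xs \<subseteq> mspace X"
      by (simp add: mag_tuples_iff)
    have "MC_map f (mag_boundary k l X (frag_of xs))
      = (\<Sum>i\<le>nat k. frag_cmul ((-1) ^ i) (MC_map f (mag_face l X i xs)))"
      using False by (simp add: mag_boundary_def MC_map_def frag_extend_sum frag_extend_cmul comp_def)
    then show ?case
      using False \<open>set xs \<subseteq> mspace X\<close> by (simp add: MC_map_mag_face mag_boundary_def)
  qed (simp_all add: MC_map_diff mag_boundary_diff)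
qed (simp add: mag_boundary_def)

lemma MC_map_mag_cycles: "z \<in> mag_cycles k l X \<Longrightarrow> MC_map f z \<in> mag_cycles k l Y"
  using MC_map_mag_boundary [of z k l] by (simp add: mag_cycles_iff MC_map_in_MC)

lemma MC_map_mag_boundaries: "b \<in> mag_boundaries k l X \<Longrightarrow> MC_map f b \<in> mag_boundaries k l Y"
  unfolding mag_boundaries_def using MC_map_mag_boundary MC_map_in_MC by fastforce

lemma MH_map_mag_class:
  assumes z: "z \<in> mag_cycles k l X"
  shows "MH_map k l X Y f (mag_class k l X z) = mag_class k l Y (MC_map f z)"
proof -
  \<comment> \<open>Two representatives differ by a boundary, whose image is again a boundary. Hence
    all members of the union in \<open>MH_map\<close> are one and the same class.\<close>
  have "mag_class k l Y (MC_map f y) = mag_class k l Y (MC_map f z)" if "y \<in> mag_class k l X z" for y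
    using that MC_map_mag_boundaries MC_map_mag_cycles [OF z]
    by (auto simp: mag_class_iff MC_map_add mag_class_add_boundary)
  then have "(\<Union>y\<in>mag_class k l X z. mag_class k l Y (MC_map f y)) = mag_class k l Y (MC_map f z)"
    \<comment> \<open>A constant union equals its common member only over a nonempty index set; the
      class contains \<open>z\<close> itself.\<close>
    by (intro UN_constant_eq [OF mag_class_self]) blast
  then show ?thesis
    using z by (simp add: MH_map_def carrier_MH)
qed

lemma MH_map_in_hom: "MH_map k l X Y f \<in> hom (MH k l X) (MH k l Y)"
proof (rule homI)
  fix c
  assume "c \<in> carrier (MH k l X)"
  then show "MH_map k l X Y f c \<in> carrier (MH k l Y)"
    by (auto simp: carrier_MH MH_map_mag_class MC_map_mag_cycles)
next
  fix c d
  assume "c \<in> carrier (MH k l X)" "d \<in> carrier (MH k l X)"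
  then show "MH_map k l X Y f (c \<otimes>\<^bsub>MH k l X\<^esub> d) = MH_map k l X Y f c \<otimes>\<^bsub>MH k l Y\<^esub> MH_map k l X Y f d"
    by (auto simp: carrier_MH mult_MH MH_map_mag_class MC_map_mag_cycles mag_cycles_add MC_map_add)
qed

end

section \<open>Identities and composites of isometric embeddings, and of the maps they
  induce\<close>

lemma isometric_embeddings_funcset: "f \<in> isometric_embeddings X Y \<Longrightarrow> f \<in> mspace X \<rightarrow> mspace Y"
  by (simp add: isometric_embeddings_def PiE_def)

lemma isometric_embeddings_extensional: "f \<in> isometric_embeddings X Y \<Longrightarrow> f \<in> extensional (mspace X)"
  by (simp add: isometric_embeddings_def PiE_def)

lemma isometric_embeddings_id: "(\<lambda>x\<in>mspace X. x) \<in> isometric_embeddings X X"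
  by (auto simp: isometric_embeddings_def inj_on_def)

lemma isometric_embeddings_compose:
  assumes "f \<in> isometric_embeddings X Y" "g \<in> isometric_embeddings Y Z"
  shows "compose (mspace X) g f \<in> isometric_embeddings X Z"
  using assms unfolding isometric_embeddings_def
  by (auto simp: compose_eq Pi_iff PiE_iff inj_on_def compose_def)

lemma MH_map_extensional: "MH_map k l X Y f \<in> extensional (carrier (MH k l X))"
  by (simp add: MH_map_def)

text \<open>Both sides are undefined off the carrier, so they need only be compared on classes,
  where a cycle representative reduces the claim to chains. Composites are treated the same
  way.\<close>

lemma MH_map_id: "MH_map k l X X (\<lambda>x\<in>mspace X. x) = (\<lambda>c\<in>carrier (MH k l X). c)"
proof (rule extensionalityI [OF MH_map_extensional restrict_extensional])
  fix c
  assume c: "c \<in> carrier (MH k l X)"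
  then obtain z where z: "z \<in> mag_cycles k l X" "c = mag_class k l X z"
    by (auto simp: carrier_MH)
  moreover have "MC_map (\<lambda>x\<in>mspace X. x) z = z"
    using z(1) by (simp add: mag_cycles_iff MC_map_id [of z k l])
  ultimately show "MH_map k l X X (\<lambda>x\<in>mspace X. x) c = (\<lambda>c\<in>carrier (MH k l X). c) c"
    using c by (simp add: MH_map_mag_class [OF isometric_embeddings_id])
qed

lemma MH_map_compose:
  assumes f: "f \<in> isometric_embeddings X Y" and g: "g \<in> isometric_embeddings Y Z"
  shows "MH_map k l X Z (compose (mspace X) g f)
    = compose (carrier (MH k l X)) (MH_map k l Y Z g) (MH_map k l X Y f)"
proof (rule extensionalityI [OF MH_map_extensional compose_extensional])
  fix c
  assume c: "c \<in> carrier (MH k l X)"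
  then obtain z where z: "z \<in> mag_cycles k l X" "c = mag_class k l X z"
    by (auto simp: carrier_MH)
  moreover have "MC_map (compose (mspace X) g f) z = MC_map g (MC_map f z)"
    using z(1) by (simp add: mag_cycles_iff MC_map_compose [of z k l])
  ultimately show "MH_map k l X Z (compose (mspace X) g f) c
    = compose (carrier (MH k l X)) (MH_map k l Y Z g) (MH_map k l X Y f) c"
    using c by (simp add: compose_eq MH_map_mag_class [OF f] MH_map_mag_class [OF g]
        MH_map_mag_class [OF isometric_embeddings_compose [OF f g]] MC_map_mag_cycles [OF f])
qed

section \<open>Functoriality\<close>

lemma category_FinMet_iso: "category FinMet_iso"
proof
  fix W X Y Z :: "'a metric" and f g h
  assume "f \<in> Hom FinMet_iso W X" "g \<in> Hom FinMet_iso X Y" "h \<in> Hom FinMet_iso Y Z"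
  then show "Comp FinMet_iso W Y Z h (Comp FinMet_iso W X Y g f)
    = Comp FinMet_iso W X Z (Comp FinMet_iso X Y Z h g) f"
    \<comment> \<open>On the right \<open>h\<close> after \<open>g\<close> is cut off outside
      \<open>mspace X\<close>; since \<open>f\<close> takes its values in \<open>mspace X\<close>,
      the cut is invisible.\<close>
    by (simp add: FinMet_iso_def compose_assoc [OF isometric_embeddings_funcset])
next
  fix X Y :: "'a metric" and f
  assume "f \<in> Hom FinMet_iso X Y"
  then have f: "f \<in> isometric_embeddings X Y"
    by (simp add: FinMet_iso_def)
  \<comment> \<open>The unit laws are equalities of HOL functions: composing with an identity
    restricts \<open>f\<close> to \<open>mspace X\<close>, which returns \<open>f\<close> because it
    is extensional.\<close>
  note f_fun = isometric_embeddings_funcset [OF f] isometric_embeddings_extensional [OF f]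
  show "Comp FinMet_iso X X Y f (Id FinMet_iso X) = f"
    using compose_Id [OF f_fun] by (simp add: FinMet_iso_def)
  show "Comp FinMet_iso X Y Y (Id FinMet_iso Y) f = f"
    using Id_compose [OF f_fun] by (simp add: FinMet_iso_def)
qed (simp_all add: FinMet_iso_def isometric_embeddings_id isometric_embeddings_compose)

lemma category_Ab: "category Ab"
proof
  fix W X Y Z :: "'b monoid" and f g h
  assume "f \<in> Hom Ab W X" "g \<in> Hom Ab X Y" "h \<in> Hom Ab Y Z"
  then show "Comp Ab W Y Z h (Comp Ab W X Y g f) = Comp Ab W X Z (Comp Ab X Y Z h g) f"
    by (auto simp: Ab_def hom_def intro: compose_assoc)
next
  fix X Y Z :: "'b monoid" and f g
  assume "X \<in> Obj Ab" "f \<in> Hom Ab X Y" "g \<in> Hom Ab Y Z"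
  then show "Comp Ab X Y Z g f \<in> Hom Ab X Z"
    by (auto simp: Ab_def comm_group_def intro: group.hom_compose)
qed (auto simp: Ab_def hom_def comm_group_def comm_monoid_def monoid.m_closed
    intro: compose_Id Id_compose)

lemma cat_functor_MH: "cat_functor FinMet_iso Ab (MH k l) (MH_map k l)"
proof (intro cat_functor.intro category_FinMet_iso category_Ab cat_functor_axioms.intro)
qed (simp_all add: FinMet_iso_def Ab_def comm_group_MH MH_map_in_hom MH_map_extensional MH_map_id
    MH_map_compose)

text \<open>The first two conjuncts certify the data of the functor: the boundary squares to zero,
  so the quotient makes sense, and the union defining \<open>MH_map\<close> really is the class of
  the image cycle.\<close>

theorem theorem1p1:
  fixes k :: int and l :: real
  assumes "k \<ge> 0" and "l \<ge> 0"
  shows "(\<forall>X \<in> Obj (FinMet_iso :: ('a metric, 'a \<Rightarrow> 'a) cat_data).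
            \<forall>c \<in> carrier (MC (k + 1) l X). mag_boundary k l X (mag_boundary (k + 1) l X c) = 0)
       \<and> (\<forall>X \<in> Obj (FinMet_iso :: ('a metric, 'a \<Rightarrow> 'a) cat_data). \<forall>Y \<in> Obj FinMet_iso.
            \<forall>f \<in> Hom FinMet_iso X Y. \<forall>z \<in> mag_cycles k l X.
              MC_map f z \<in> mag_cycles k l Y \<and>
              MH_map k l X Y f (mag_class k l X z) = mag_class k l Y (MC_map f z))
       \<and> cat_functor (FinMet_iso :: ('a metric, 'a \<Rightarrow> 'a) cat_data) Ab (MH k l) (MH_map k l)"
proof (intro conjI ballI)
  fix X Y :: "'a metric" and f z
  assume "f \<in> Hom FinMet_iso X Y" and z: "z \<in> mag_cycles k l X"
  then have f: "f \<in> isometric_embeddings X Y"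
    by (simp add: FinMet_iso_def)
  show "MC_map f z \<in> mag_cycles k l Y"
    by (rule MC_map_mag_cycles [OF f z])
  show "MH_map k l X Y f (mag_class k l X z) = mag_class k l Y (MC_map f z)"
    by (rule MH_map_mag_class [OF f z])
qed (simp_all add: mag_boundary_mag_boundary cat_functor_MH)

end
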